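(* For all integers $t \geq 2$ and $n \geq 1$, $\lambda(n, C_{2t}) \leq 12\, t\, n^{1/(2t)}$.
   Context: An orthonormal representation of a graph $G$ is a map $f: V(G) \to \mathbb{R}^d$ (some $d$) with $\|f(u)\|=1$ for all $u$ and $\langle f(u), f(v)\rangle = 0$ for all distinct non-adjacent $u,v$. For a graph $G$, $\vartheta(\overline{G})$ equals the maximum, over all orthonormal representations $f$ of $G$, of the largest eigenvalue of the Gram matrix $(\langle f(u), f(v)\rangle)_{u,v}$. A graph is $H$-free if it contains no (not necessarily induced) subgraph isomorphic to $H$. $\lambda(n,H)$ denotes the maximum of $\vartheta(\overline{G})$ over all $H$-free simple graphs $G$ on $n$ vertices. $C_{2t}$ is the cycle of length $2t$. *)

theory Defs
  imports
    "Graph_Theory.Graph_Theory"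
    "Jordan_Normal_Form.Spectral_Radius"
begin

text \<open>Finite simple graphs are the symmetric loop-free digraphs of the locale \<^locale>\<open>pair_graph\<close>,
  each edge being represented by both of its orientations.\<close>

definition complement_graph :: "'a pair_pre_digraph \<Rightarrow> 'a pair_pre_digraph" where
  "complement_graph G =
     \<lparr> pverts = pverts G,
       parcs = {(u, v). u \<in> pverts G \<and> v \<in> pverts G \<and> u \<noteq> v \<and> (u, v) \<notin> parcs G} \<rparr>"

text \<open>This is the cycle on \<open>k\<close> vertices only for \<open>k \<ge> 3\<close>.\<close>

definition cycle_graph :: "nat \<Rightarrow> nat pair_pre_digraph" where
  "cycle_graph k =
     \<lparr> pverts = {..<k},
       parcs = {(i, j). i < k \<and> j < k \<and> (j = Suc i mod k \<or> i = Suc j mod k)} \<rparr>"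

text \<open>The subgraph \<open>K\<close> need not be induced.  Although \<^const>\<open>subgraph\<close> is a notion for digraphs,
  a \<open>K\<close> isomorphic to a symmetric \<open>H\<close> is itself symmetric.\<close>

definition is_free :: "'b pair_pre_digraph \<Rightarrow> 'a pair_pre_digraph \<Rightarrow> bool" where
  "is_free H G \<longleftrightarrow> \<not> (\<exists>K. subgraph K (with_proj G) \<and> digraph_iso K (with_proj H))"

definition orthonormal_rep :: "'a pair_pre_digraph \<Rightarrow> nat \<Rightarrow> ('a \<Rightarrow> real vec) \<Rightarrow> bool" where
  "orthonormal_rep G d f \<longleftrightarrow>
     (\<forall>u \<in> pverts G. f u \<in> carrier_vec d \<and> f u \<bullet> f u = 1) \<and>
     (\<forall>u \<in> pverts G. \<forall>v \<in> pverts G. u \<noteq> v \<and> (u, v) \<notin> parcs G \<longrightarrow> f u \<bullet> f v = 0)"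

text \<open>Rows and columns are indexed by the positions in the list \<open>vs\<close>, an enumeration of the
  vertices.\<close>

definition gram_matrix :: "('a \<Rightarrow> real vec) \<Rightarrow> 'a list \<Rightarrow> real mat" where
  "gram_matrix f vs = mat (length vs) (length vs) (\<lambda>(i, j). f (vs ! i) \<bullet> f (vs ! j))"

definition largest_eigenvalue :: "real mat \<Rightarrow> real" where
  "largest_eigenvalue A = Max (spectrum A)"

text \<open>The Lovasz theta function of a finite graph with at least one vertex: with the convention that
  non-adjacent vertices are mapped to orthogonal vectors, the representations involved are those of
  the complement.  The set is nonempty and bounded above by the number of vertices, so the supremum
  is a genuine one.\<close>

definition lovasz_theta :: "'a::linorder pair_pre_digraph \<Rightarrow> real" where
  "lovasz_theta G =
     Sup {largest_eigenvalue (gram_matrix f (sorted_list_of_set (pverts G))) | d f.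
            orthonormal_rep (complement_graph G) d f}"

text \<open>Graphs on \<open>n\<close> vertices are taken, up to isomorphism, on the vertex set \<open>{..<n}\<close>.\<close>

definition free_graphs :: "nat \<Rightarrow> 'b pair_pre_digraph \<Rightarrow> nat pair_pre_digraph set" where
  "free_graphs n H = {G. pair_graph G \<and> pverts G = {..<n} \<and> is_free H G}"

definition lambda_free :: "nat \<Rightarrow> 'b pair_pre_digraph \<Rightarrow> real" where
  "lambda_free n H = Max ((\<lambda>G. lovasz_theta (complement_graph G)) ` free_graphs n H)"

lemma complement_graph_involution:
  assumes "pair_graph G"
  shows "complement_graph (complement_graph G) = G"
proof -
  interpret pair_graph G by fact
  have "parcs (complement_graph (complement_graph G)) = parcs G"
    by (auto simp: complement_graph_def dest: in_arcsD1 in_arcsD2 no_loops')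
  then show ?thesis
    by (simp add: complement_graph_def)
qed

lemma lovasz_theta_complement:
  assumes "pair_graph G"
  shows "lovasz_theta (complement_graph G) =
    Sup {largest_eigenvalue (gram_matrix f (sorted_list_of_set (pverts G))) | d f.
           orthonormal_rep G d f}"
  unfolding lovasz_theta_def complement_graph_involution[OF assms]
  by (simp add: complement_graph_def)

lemma pair_graph_cycle_graph:
  assumes "k \<ge> 3"
  shows "pair_graph (cycle_graph k)"
proof -
  have loop: "Suc i mod k \<noteq> i" if "i < k" for i
    using that assms by (cases "Suc i = k") auto
  have "finite (parcs (cycle_graph k))"
    by (rule finite_subset[of _ "{..<k} \<times> {..<k}"]) (auto simp: cycle_graph_def)
  then show ?thesis
    using loop
    by unfold_locales (auto simp: cycle_graph_def symmetric_def sym_def, metis+)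
qed

lemma finite_free_graphs: "finite (free_graphs n H)"
proof (rule finite_subset)
  show "free_graphs n H \<subseteq>
    (\<lambda>E. \<lparr> pverts = {..<n}, parcs = E \<rparr>) ` Pow ({..<n} \<times> {..<n})"
  proof
    fix G assume G: "G \<in> free_graphs n H"
    then interpret pair_graph G by (simp add: free_graphs_def)
    have V: "pverts G = {..<n}" using G by (simp add: free_graphs_def)
    have "parcs G \<subseteq> {..<n} \<times> {..<n}"
      using in_arcsD1 in_arcsD2 unfolding V by auto
    moreover have "G = \<lparr> pverts = {..<n}, parcs = parcs G \<rparr>"
      using V by simp
    ultimately show "G \<in> (\<lambda>E. \<lparr> pverts = {..<n}, parcs = E \<rparr>) ` Pow ({..<n} \<times> {..<n})"
      by blast
  qed
qed simp

lemma free_graphs_cycle_nonempty: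
  assumes "k \<ge> 3"
  shows "free_graphs n (cycle_graph k) \<noteq> {}"
proof -
  let ?E = "\<lparr> pverts = {..<n}, parcs = {} \<rparr> :: nat pair_pre_digraph"
  have "pair_graph ?E"
    by unfold_locales (auto simp: symmetric_def sym_def)
  moreover have "is_free (cycle_graph k) ?E"
  proof -
    have "(0, Suc 0) \<in> parcs (cycle_graph k)"
      using assms by (auto simp: cycle_graph_def)
    moreover have "parcs (cycle_graph k) = {}"
      if "subgraph K (with_proj ?E)" "digraph_iso K (with_proj (cycle_graph k))" for K
    proof -
      have "arcs K = {}" using that(1) by (auto simp: subgraph_def)
      then have "arcs (with_proj (cycle_graph k)) = {}"
        using that(2) unfolding digraph_iso_def by (metis arcs_app_iso image_empty)
      then show ?thesis by simp
    qed
    ultimately show ?thesis unfolding is_free_def by blast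
  qed
  ultimately have "?E \<in> free_graphs n (cycle_graph k)"
    by (simp add: free_graphs_def)
  then show ?thesis by blast
qed

end

theory Submission
  imports Defs
begin

text \<open>
Let \<open>f\<close> be an orthonormal representation of a \<open>C\<^sub>2\<^sub>t\<close>-free graph \<open>G\<close> with Gram matrix \<open>M\<close>.

A neighbourhood contains no path on \<open>2 * t - 1\<close> vertices, so it is \<open>(2 * t - 2)\<close>-degenerate and
\<open>2 * t - 1\<close> colours suffice for it; Bessel's inequality in each colour class bounds the sum of \<open>(M u v)\<^sup>2\<close>
over the neighbours \<open>v\<close> of \<open>u\<close> by \<open>K = 2 * t - 1\<close>.

In the manner of Bondy and Simonovits, \<open>G\<close> is \<open>d\<close>-degenerate with \<open>d = 16 * (t - 1) * n powr (1 / t)\<close>: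
in a bipartite subgraph keeping half of each degree, the graph between two consecutive layers of a
breadth-first search is sparse up to depth \<open>t\<close>, so that a large minimum degree would make the layers grow
beyond \<open>n\<close>.

Weighting each edge asymmetrically along a degenerate order bounds the quadratic form of \<open>M\<close> by
\<open>1 + c * d + K / c\<close> for each \<open>c > 0\<close>, and \<open>c\<close> of the order of \<open>n powr (- 1 / (2 * t))\<close> gives the theorem.
\<close>

section \<open>Degenerate graphs\<close>

text \<open>The bound is a real number because the one obtained for the whole graph is a multiple of
  a real power of the number of vertices.\<close>

definition degenerate :: "('a \<Rightarrow> 'a \<Rightarrow> bool) \<Rightarrow> real \<Rightarrow> 'a set \<Rightarrow> bool" where
  "degenerate E d W \<longleftrightarrow> (\<forall>U\<subseteq>W. U \<noteq> {} \<longrightarrow> (\<exists>v\<in>U. real (card {u \<in> U. E v u}) \<le> d))"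

lemma degenerate_subset: "degenerate E d W \<Longrightarrow> U \<subseteq> W \<Longrightarrow> degenerate E d U"
  unfolding degenerate_def by blast

text \<open>Removing a vertex of small degree again and again exhausts \<open>W\<close>; read
  backwards, \<open>W\<close> is built up so that each new vertex has degree at most
  \<open>d\<close> on arrival.\<close>

lemma degenerate_induct [consumes 2, case_names empty insert]:
  assumes "finite W" "degenerate E d W"
    and "P {}"
    and step: "\<And>v U. \<lbrakk>finite U; v \<notin> U; insert v U \<subseteq> W; real (card {u \<in> insert v U. E v u}) \<le> d; P U\<rbrakk>
      \<Longrightarrow> P (insert v U)"
  shows "P W"
proof -
  have "P U" if "U \<subseteq> W" for U
    using finite_subset[OF that assms(1)] that
  proof (induction U rule: finite_psubset_induct)
    case (psubset U)
    show ?case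
    proof (cases "U = {}")
      case False
      then obtain v where v: "v \<in> U" "real (card {u \<in> U. E v u}) \<le> d"
        using assms(2) psubset.prems unfolding degenerate_def by blast
      have "P (U - {v})" using psubset v(1) by blast
      then have "P (insert v (U - {v}))"
        using psubset v by (intro step) (auto simp: insert_absorb)
      then show ?thesis using v(1) by (simp add: insert_absorb)
    qed (use assms(3) in simp)
  qed
  then show ?thesis by blast
qed

text \<open>Each new vertex of a degenerate order brings at most \<open>d\<close> arcs. As
  \<open>A\<close> and \<open>B\<close> are disjoint, an edge between them counts in one orientation
  only, and no factor 2 arises.\<close>

lemma degenerate_card_arcs_le:
  assumes "finite W" "degenerate E d W" "symp E" "A \<inter> B = {}"
  shows "real (card {(a, b). a \<in> W \<inter> A \<and> b \<in> W \<inter> B \<and> E a b}) \<le> d * real (card W)"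
  using assms(1,2)
proof (induction rule: degenerate_induct)
  case (insert v U)
  let ?P = "\<lambda>U. {(a, b). a \<in> U \<inter> A \<and> b \<in> U \<inter> B \<and> E a b}"
  let ?N = "{u \<in> insert v U. E v u}"
  have fin: "finite ?N" "finite (?P U)"
    using insert(1) finite_subset[of "?P U" "U \<times> U"] by auto
  \<comment> \<open>The vertex \<open>v\<close> lies in at most one of \<open>A\<close> and
    \<open>B\<close>, so the new arcs all start at \<open>v\<close> or all end at
    \<open>v\<close>.\<close>
  have "?P (insert v U) \<subseteq> ?P U \<union> Pair v ` ?N \<or> ?P (insert v U) \<subseteq> ?P U \<union> (\<lambda>u. (u, v)) ` ?N"
    using assms(3,4) by (cases "v \<in> A") (auto dest: sympD)
  then have "card (?P (insert v U)) \<le> card (?P U) + card ?N"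
  proof
    assume "?P (insert v U) \<subseteq> ?P U \<union> Pair v ` ?N"
    then have "card (?P (insert v U)) \<le> card (?P U \<union> Pair v ` ?N)"
      using fin by (intro card_mono) auto
    also have "\<dots> \<le> card (?P U) + card ?N"
      using card_Un_le[of "?P U" "Pair v ` ?N"] card_image_le[OF fin(1), of "Pair v"] by linarith
    finally show ?thesis .
  next
    assume "?P (insert v U) \<subseteq> ?P U \<union> (\<lambda>u. (u, v)) ` ?N"
    then have "card (?P (insert v U)) \<le> card (?P U \<union> (\<lambda>u. (u, v)) ` ?N)"
      using fin by (intro card_mono) auto
    also have "\<dots> \<le> card (?P U) + card ?N"
      using card_Un_le[of "?P U" "(\<lambda>u. (u, v)) ` ?N"] card_image_le[OF fin(1), of "(\<lambda>u. (u, v))"] by linarith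
    finally show ?thesis .
  qed
  then have "real (card (?P (insert v U))) \<le> real (card (?P U)) + real (card ?N)" by linarith
  also have "\<dots> \<le> d * real (card U) + d"
    using insert(4,5) by linarith
  also have "\<dots> = d * real (card (insert v U))"
    using insert(1,2) by (simp add: algebra_simps)
  finally show ?case .
qed simp

text \<open>Greedy colouring along a degenerate order: the at most \<open>d\<close> earlier
  neighbours of a new vertex leave one of the \<open>d + 1\<close> colours free.\<close>

lemma degenerate_colouring:
  assumes "finite W" "degenerate E (real d) W" "symp E"
  obtains c :: "'a \<Rightarrow> nat" where "c ` W \<subseteq> {..d}"
    and "\<And>u v. u \<in> W \<Longrightarrow> v \<in> W \<Longrightarrow> u \<noteq> v \<Longrightarrow> E u v \<Longrightarrow> c u \<noteq> c v"
proof -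
  have "\<exists>c :: 'a \<Rightarrow> nat. c ` W \<subseteq> {..d} \<and> (\<forall>u\<in>W. \<forall>v\<in>W. u \<noteq> v \<longrightarrow> E u v \<longrightarrow> c u \<noteq> c v)"
    using assms(1,2)
  proof (induction rule: degenerate_induct)
    case (insert v U)
    then obtain c :: "'a \<Rightarrow> nat" where c: "c ` U \<subseteq> {..d}"
      "\<forall>u\<in>U. \<forall>v\<in>U. u \<noteq> v \<longrightarrow> E u v \<longrightarrow> c u \<noteq> c v" by blast
    let ?N = "{u \<in> insert v U. E v u}"
    have "card (c ` ?N) \<le> card ?N" using insert(1) by (intro card_image_le) simp
    also have "\<dots> < card {..d}" using insert(4) by simp
    finally have "\<not> {..d} \<subseteq> c ` ?N"
      using insert(1) card_mono[of "c ` ?N" "{..d}"] by auto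
    then obtain k where k: "k \<le> d" "k \<notin> c ` ?N" by auto
    show ?case
    proof (intro exI[of _ "c(v := k)"] conjI ballI impI)
      show "(c(v := k)) ` insert v U \<subseteq> {..d}" using c(1) k(1) by auto
      fix u w assume "u \<in> insert v U" "w \<in> insert v U" "u \<noteq> w" "E u w"
      then show "(c(v := k)) u \<noteq> (c(v := k)) w"
        using c(2) k(2) sympD[OF assms(3), of u w] by auto
    qed
  qed simp
  then show ?thesis using that by blast
qed

text \<open>Each edge is charged to the endpoint that is removed first in a degenerate order; this
  endpoint has at most \<open>d\<close> remaining neighbours, while the other one sees the square of the weight.\<close>

lemma degenerate_quadratic_form_le:
  fixes a :: "'a \<Rightarrow> real" and M :: "'a \<Rightarrow> 'a \<Rightarrow> real"
  assumes "finite W" "degenerate E d W" "symp E" "irreflp E"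
    and sym: "\<And>u v. M u v = M v u" and c: "c > 0"
  shows "(\<Sum>u\<in>W. \<Sum>v\<in>{v\<in>W. E u v}. a u * a v * M u v)
    \<le> c * d * (\<Sum>u\<in>W. (a u)\<^sup>2) + (\<Sum>v\<in>W. (a v)\<^sup>2 * (\<Sum>u\<in>{u\<in>W. E v u}. (M v u)\<^sup>2)) / c"
  using assms(1,2)
proof (induction rule: degenerate_induct)
  case (insert w U)
  let ?N = "{u \<in> U. E w u}"
  have Nw: "{u \<in> insert w U. E w u} = ?N" using assms(4) by (auto dest: irreflpD)
  \<comment> \<open>Both orientations of an edge occur in the double sum, so \<open>w\<close> adds a
    row and a column. The identity is used for the form and for the squares.\<close>
  have split: "(\<Sum>u\<in>insert w U. \<Sum>v\<in>{v\<in>insert w U. E u v}. g u v)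
     = (\<Sum>u\<in>U. \<Sum>v\<in>{v\<in>U. E u v}. g u v) + (\<Sum>v\<in>?N. g w v) + (\<Sum>u\<in>?N. g u w)" for g :: "'a \<Rightarrow> 'a \<Rightarrow> real"
  proof -
    have "(\<Sum>v\<in>{v\<in>insert w U. E u v}. g u v) = (\<Sum>v\<in>{v\<in>U. E u v}. g u v) + (if E u w then g u w else 0)"
      if "u \<in> U" for u
    proof -
      have "{v\<in>insert w U. E u v} = (if E u w then insert w {v\<in>U. E u v} else {v\<in>U. E u v})" by auto
      then show ?thesis using insert(1,2) by (auto simp: add.commute)
    qed
    then have "(\<Sum>u\<in>U. \<Sum>v\<in>{v\<in>insert w U. E u v}. g u v)
      = (\<Sum>u\<in>U. \<Sum>v\<in>{v\<in>U. E u v}. g u v) + (\<Sum>u\<in>U. if E u w then g u w else 0)"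
      by (simp add: sum.distrib)
    also have "(\<Sum>u\<in>U. if E u w then g u w else 0) = (\<Sum>u\<in>{u\<in>U. E u w}. g u w)"
      using insert(1) by (simp add: sum.inter_filter)
    also have "{u\<in>U. E u w} = ?N" using assms(3) by (auto dest: sympD)
    finally show ?thesis using insert(1,2) Nw by simp
  qed
  have amgm: "2 * (a w * a u * M w u) \<le> c * (a w)\<^sup>2 + (a u)\<^sup>2 * (M w u)\<^sup>2 / c" for u
  proof -
    have "0 \<le> (c * a w - a u * M w u)\<^sup>2 / c" using c by simp
    also have "\<dots> = c * (a w)\<^sup>2 + (a u)\<^sup>2 * (M w u)\<^sup>2 / c - 2 * (a w * a u * M w u)"
      using c by (simp add: field_simps power2_eq_square)
    finally show ?thesis by simp
  qed
  have "(\<Sum>v\<in>?N. a w * a v * M w v) + (\<Sum>u\<in>?N. a u * a w * M u w) = (\<Sum>u\<in>?N. 2 * (a w * a u * M w u))"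
    using sym by (simp add: sum.distrib[symmetric] mult.commute mult.left_commute)
  also have "\<dots> \<le> (\<Sum>u\<in>?N. c * (a w)\<^sup>2 + (a u)\<^sup>2 * (M w u)\<^sup>2 / c)"
    by (intro sum_mono amgm)
  also have "\<dots> = c * (a w)\<^sup>2 * real (card ?N) + (\<Sum>u\<in>?N. (a u)\<^sup>2 * (M u w)\<^sup>2) / c"
    using sym by (simp add: sum.distrib sum_divide_distrib)
  also have "\<dots> \<le> c * (a w)\<^sup>2 * d + (\<Sum>u\<in>?N. (a u)\<^sup>2 * (M u w)\<^sup>2) / c"
    using insert(4) c unfolding Nw by (intro add_right_mono mult_left_mono) auto
  \<comment> \<open>The nonnegative row of \<open>w\<close> is added so that the bound matches the
    growth of the sum of squares given by \<open>split\<close>.\<close>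
  also have "\<dots> \<le> c * (a w)\<^sup>2 * d + ((\<Sum>u\<in>?N. (a w)\<^sup>2 * (M w u)\<^sup>2) + (\<Sum>u\<in>?N. (a u)\<^sup>2 * (M u w)\<^sup>2)) / c"
    using c by (intro add_left_mono divide_right_mono) (auto intro!: sum_nonneg)
  finally have new: "(\<Sum>v\<in>?N. a w * a v * M w v) + (\<Sum>u\<in>?N. a u * a w * M u w) \<le> \<dots>" .
  show ?case
    using insert(5) new split[of "\<lambda>u v. a u * a v * M u v"] split[of "\<lambda>u v. (a u)\<^sup>2 * (M u v)\<^sup>2"] insert(1,2)
    by (simp add: sum_distrib_left algebra_simps add_divide_distrib)
qed simp

section \<open>Paths and cycles as lists of vertices\<close>

text \<open>Greedy extension: the end of a path has at least \<open>m\<close> neighbours in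
  \<open>W\<close>, and as long as the path and \<open>F\<close> together have fewer than
  \<open>m\<close> vertices, one of these neighbours is free.\<close>

lemma exists_path_avoiding:
  assumes deg: "\<And>v. v \<in> W \<Longrightarrow> m \<le> card {u \<in> W. H v u}"
    and "v \<in> W" "finite F" "v \<notin> F" "L \<ge> 1" "L + card F \<le> m"
  shows "\<exists>xs. length xs = L \<and> hd xs = v \<and> successively H xs \<and> distinct xs \<and> set xs \<subseteq> W - F"
  using assms(5,6)
proof (induction L rule: nat_induct_at_least)
  case base
  then show ?case using assms by (intro exI[of _ "[v]"]) auto
next
  case (Suc L)
  then obtain xs where xs: "length xs = L" "hd xs = v" "successively H xs" "distinct xs" "set xs \<subseteq> W - F"
    by auto
  have "xs \<noteq> []" using xs Suc by auto
  have "card (set xs \<union> F) \<le> L + card F"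
    using card_Un_le[of "set xs" F] xs(1) card_length[of xs] by linarith
  also have "\<dots> < card {u \<in> W. H (last xs) u}"
    using deg[of "last xs"] xs(5) \<open>xs \<noteq> []\<close> Suc.prems last_in_set by fastforce
  finally have "\<not> {u \<in> W. H (last xs) u} \<subseteq> set xs \<union> F"
    using card_mono[of "set xs \<union> F" "{u \<in> W. H (last xs) u}"] assms(3) by auto
  then obtain u where "u \<in> W" "H (last xs) u" "u \<notin> set xs" "u \<notin> F" by blast
  then show ?case
    using xs \<open>xs \<noteq> []\<close> by (intro exI[of _ "xs @ [u]"]) (auto simp: successively_append_iff)
qed

text \<open>Lists allow paths to be glued by \<open>@\<close>. They describe genuine cycles for
  \<open>k \<ge> 3\<close> only: with \<open>k = 2\<close>, a single edge of a symmetric relation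
  qualifies.\<close>

definition has_cycle :: "('a \<Rightarrow> 'a \<Rightarrow> bool) \<Rightarrow> nat \<Rightarrow> bool" where
  "has_cycle E k \<longleftrightarrow> (\<exists>p. length p = k \<and> distinct p \<and> successively E p \<and> E (last p) (hd p))"

lemma has_cycle_mono: "has_cycle H k \<Longrightarrow> H \<le> E \<Longrightarrow> has_cycle E k"
  unfolding has_cycle_def by (metis predicate2D successively_mono)

text \<open>A path on \<open>2 * t - 1\<close> vertices inside the neighbourhood of \<open>u\<close>
  would close up through \<open>u\<close> itself.\<close>

lemma degenerate_neighbourhood:
  assumes "symp E" "irreflp E" "\<not> has_cycle E (2 * t)" "t \<ge> 2"
  shows "degenerate E (real (2 * t - 2)) {v. E u v}"
  unfolding degenerate_def
proof (intro allI impI, rule ccontr)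
  fix U assume U: "U \<subseteq> {v. E u v}" "U \<noteq> {}"
    and large: "\<not> (\<exists>v\<in>U. real (card {w \<in> U. E v w}) \<le> real (2 * t - 2))"
  have deg: "2 * t - 1 \<le> card {w \<in> U. E v w}" if "v \<in> U" for v
  proof -
    have "2 * t - 2 < card {w \<in> U. E v w}" using large that by (auto simp flip: of_nat_le_iff)
    then show ?thesis by linarith
  qed
  obtain v where "v \<in> U" using U by blast
  have "\<exists>xs. length xs = 2 * t - 1 \<and> hd xs = v \<and> successively E xs \<and> distinct xs \<and> set xs \<subseteq> U - {}"
    by (rule exists_path_avoiding[OF deg]) (use \<open>v \<in> U\<close> assms in auto)
  then obtain xs where xs: "length xs = 2 * t - 1" "successively E xs" "distinct xs" "set xs \<subseteq> U" by auto
  then have ne: "xs \<noteq> []" using assms(4) by auto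
  then have "hd xs \<in> U" "last xs \<in> U" using xs(4) by auto
  then have "E u (hd xs)" "E u (last xs)" using U by auto
  moreover have "u \<notin> set xs" using xs U assms(2) by (auto dest: irreflpD)
  ultimately have "has_cycle E (2 * t)"
    unfolding has_cycle_def using xs ne assms
    by (intro exI[of _ "u # xs"]) (auto simp: successively_Cons dest: sympD)
  then show False using assms(3) by simp
qed

section \<open>Cuts and breadth-first layers\<close>

text \<open>In a cut with the most edges, moving \<open>v\<close> to the other side gains nothing,
  so at least half of its neighbours are already across.\<close>

lemma exists_cut_half_degrees:
  assumes "finite V" "symp E" "irreflp E"
  obtains S where "\<And>v. v \<in> V \<Longrightarrow> card {u \<in> V. E v u} \<le> 2 * card {u \<in> V. E v u \<and> (u \<in> S) \<noteq> (v \<in> S)}"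
proof -
  define cut where "cut S = {(u, w). u \<in> V \<and> w \<in> V \<and> E u w \<and> (u \<in> S) \<noteq> (w \<in> S)}" for S
  obtain S where S: "S \<in> Pow V" "\<And>T. T \<in> Pow V \<Longrightarrow> card (cut T) \<le> card (cut S)"
  proof -
    have "finite ((\<lambda>S. card (cut S)) ` Pow V)" "(\<lambda>S. card (cut S)) ` Pow V \<noteq> {}"
      using assms(1) by auto
    from Max_in[OF this] Max_ge[OF this(1)] that show ?thesis by auto
  qed
  have "card {u \<in> V. E v u} \<le> 2 * card {u \<in> V. E v u \<and> (u \<in> S) \<noteq> (v \<in> S)}" if v: "v \<in> V" for v
  proof -
    define rest where "rest S = {(u, w) \<in> cut S. u \<noteq> v \<and> w \<noteq> v}" for S
    define A where "A S = {u \<in> V. E v u \<and> (u \<in> S) \<noteq> (v \<in> S)}" for S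
    have fin: "finite (rest S)" "finite (A S)" for S
      using assms(1) finite_subset[of "rest S" "V \<times> V"] by (auto simp: rest_def cut_def A_def)
    \<comment> \<open>Moving \<open>v\<close> does not change \<open>rest\<close>, so comparing two
      such cuts amounts to comparing \<open>A\<close>. The factor 2 stands for the two
      orientations.\<close>
    have card_cut: "card (cut S) = card (rest S) + 2 * card (A S)" for S
    proof -
      have "cut S = (rest S \<union> Pair v ` A S) \<union> (\<lambda>u. (u, v)) ` A S"
        using v assms(2) by (auto simp: rest_def cut_def A_def dest: sympD)
      also have "card \<dots> = card (rest S \<union> Pair v ` A S) + card ((\<lambda>u. (u, v)) ` A S)"
        using fin assms(3) by (intro card_Un_disjoint) (auto simp: rest_def A_def dest: irreflpD)
      also have "card (rest S \<union> Pair v ` A S) = card (rest S) + card (Pair v ` A S)"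
        using fin by (intro card_Un_disjoint) (auto simp: rest_def)
      finally show ?thesis by (simp add: card_image inj_on_def)
    qed
    define T where "T = (if v \<in> S then S - {v} else insert v S)"
    have T: "u \<in> T \<longleftrightarrow> u \<in> S" if "u \<noteq> v" for u using that by (auto simp: T_def)
    have Tv: "v \<in> T \<longleftrightarrow> v \<notin> S" by (auto simp: T_def)
    have "T \<in> Pow V" using S(1) v by (auto simp: T_def)
    moreover have "rest T = rest S" using T by (auto simp: rest_def cut_def)
    ultimately have "card (A T) \<le> card (A S)" using S(2)[of T] card_cut by simp
    have ne: "u \<noteq> v" if "E v u" for u using that assms(3) by (auto dest: irreflpD)
    have "A T = {u \<in> V. E v u \<and> (u \<in> S) = (v \<in> S)}"
      unfolding A_def Tv using T ne by blast
    then have "{u \<in> V. E v u} = A S \<union> A T" by (auto simp: A_def)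
    then have "card {u \<in> V. E v u} \<le> card (A S) + card (A T)" using card_Un_le[of "A S" "A T"] by simp
    with \<open>card (A T) \<le> card (A S)\<close> show ?thesis by (simp add: A_def)
  qed
  then show ?thesis using that by blast
qed

text \<open>\<open>E ^^ i\<close> relates the ends of walks of length \<open>i\<close>, so this is
  the sphere of radius \<open>i\<close> about \<open>x\<close>.\<close>

definition layer :: "('a \<Rightarrow> 'a \<Rightarrow> bool) \<Rightarrow> 'a \<Rightarrow> nat \<Rightarrow> 'a set" where
  "layer E x i = {v. (E ^^ i) x v \<and> (\<forall>j<i. \<not> (E ^^ j) x v)}"

lemma layer_0 [simp]: "layer E x 0 = {x}"
  by (auto simp: layer_def)

lemma layer_unique: "v \<in> layer E x i \<Longrightarrow> v \<in> layer E x j \<Longrightarrow> i = j"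
  by (cases i j rule: linorder_cases) (auto simp: layer_def)

lemma layer_SucE:
  assumes "v \<in> layer E x (Suc i)"
  obtains u where "u \<in> layer E x i" "E u v"
proof -
  from assms obtain u where u: "(E ^^ i) x u" "E u v"
    by (auto simp: layer_def elim: relpowp_Suc_E)
  have "\<not> (E ^^ j) x u" if "j < i" for j
  proof
    assume "(E ^^ j) x u"
    then have "(E ^^ Suc j) x v" using u(2) by (rule relpowp_Suc_I)
    moreover have "Suc j < Suc i" using that by simp
    ultimately show False using assms unfolding layer_def by blast
  qed
  then show ?thesis using that u by (auto simp: layer_def)
qed

lemma layer_step:
  assumes "symp E" "u \<in> layer E x i" "E u v"
  obtains j where "v \<in> layer E x j" "j \<le> Suc i" "i \<le> Suc j"
proof -
  have "(E ^^ Suc i) x v" using assms(2,3) by (auto simp: layer_def intro: relpowp_Suc_I)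
  then have "\<exists>j. (E ^^ j) x v" by blast
  then obtain j where j: "(E ^^ j) x v" "\<And>k. (E ^^ k) x v \<Longrightarrow> j \<le> k"
    unfolding exists_least_iff[of "\<lambda>j. (E ^^ j) x v"] by (meson not_less)
  then have "\<forall>k<j. \<not> (E ^^ k) x v" by (meson not_less)
  with j(1) have "v \<in> layer E x j" by (simp add: layer_def)
  moreover have "j \<le> Suc i" using j \<open>(E ^^ Suc i) x v\<close> by blast
  moreover have "(E ^^ Suc j) x u"
    using relpowp_Suc_I[OF j(1)] assms(1,3) by (auto dest: sympD)
  then have "\<not> Suc j < i" using assms(2) unfolding layer_def by blast
  then have "i \<le> Suc j" by simp
  ultimately show ?thesis using that by blast
qed

lemma relpowp_bipartite_parity:
  assumes "\<And>u v. E u v \<Longrightarrow> (u \<in> S) \<noteq> (v \<in> S)" "(E ^^ i) x v"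
  shows "(v \<in> S \<longleftrightarrow> x \<in> S) \<longleftrightarrow> even i"
  using assms(2)
proof (induction i arbitrary: v)
  case (Suc i)
  then obtain u where "(E ^^ i) x u" "E u v" by (auto elim: relpowp_Suc_E)
  then show ?case using Suc.IH[of u] assms(1)[of u v] by auto
qed simp

text \<open>The parity of the level determines the side of the bipartition, so no edge lies inside a
  layer.\<close>

lemma layer_step_bipartite:
  assumes "symp E" "\<And>u v. E u v \<Longrightarrow> (u \<in> S) \<noteq> (v \<in> S)" "u \<in> layer E x i" "E u v"
  shows "v \<in> layer E x (Suc i) \<or> (\<exists>j. i = Suc j \<and> v \<in> layer E x j)"
proof -
  obtain j where j: "v \<in> layer E x j" "j \<le> Suc i" "i \<le> Suc j"
    using layer_step[OF assms(1,3,4)] .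
  have "j \<noteq> i"
    using relpowp_bipartite_parity[OF assms(2), where x = x and i = i and v = u] relpowp_bipartite_parity[OF assms(2), where x = x and i = j and v = v]
      assms(2)[OF assms(4)] assms(3) j(1) by (auto simp: layer_def)
  then have "j = Suc i \<or> i = Suc j" using j(2,3) by linarith
  then show ?thesis using j(1) by blast
qed

section \<open>Edges between consecutive layers\<close>

text \<open>The tree paths from \<open>x\<close> and \<open>x'\<close> first meet after
  \<open>Suc h\<close> steps. The cycle follows \<open>p\<close> from \<open>x\<close> to
  \<open>x'\<close>, climbs to the common ancestor and descends to \<open>x\<close>; the ancestors
  lie in layers before \<open>i\<close>, hence off \<open>p\<close>.\<close>

lemma tree_path_cycle:
  assumes sym: "symp E"
    and par: "\<And>l v. v \<in> layer E z (Suc l) \<Longrightarrow> par v \<in> layer E z l \<and> E v (par v)"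
    and x: "x \<in> layer E z i" and x': "x' \<in> layer E z i" and hi: "Suc h \<le> i"
    and p: "successively E p" "distinct p" "p \<noteq> []" "hd p = x" "last p = x'"
      "set p \<subseteq> layer E z i \<union> layer E z (Suc i)"
    and eq: "(par ^^ Suc h) x = (par ^^ Suc h) x'" and ne: "(par ^^ h) x \<noteq> (par ^^ h) x'"
  shows "has_cycle E (length p + 2 * h + 1)"
proof -
  have anc: "(par ^^ k) v \<in> layer E z (i - k)" if "k \<le> i" "v \<in> layer E z i" for k v
    using that
  proof (induction k)
    case (Suc k)
    then have "(par ^^ k) v \<in> layer E z (Suc (i - Suc k))" by (simp add: Suc_diff_Suc)
    then show ?case using par by simp
  qed simp
  have anc_edge: "E ((par ^^ k) v) (par ((par ^^ k) v))" if "k < i" "v \<in> layer E z i" for k v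
    using par[of "(par ^^ k) v" "i - Suc k"] anc[of k v] that by (simp add: Suc_diff_Suc)
  \<comment> \<open>The common ancestor belongs to \<open>q\<close> only: \<open>q\<close> has
    \<open>h + 1\<close> vertices and \<open>r\<close> has \<open>h\<close>, so \<open>r\<close> is
    empty for \<open>h = 0\<close>.\<close>
  define q where "q = map (\<lambda>k. (par ^^ k) x') [1..<Suc (Suc h)]"
  define r where "r = map (\<lambda>k. (par ^^ k) x) [1..<Suc h]"
  have succ_anc: "successively E (map (\<lambda>k. (par ^^ k) v) [1..<m])" if "m \<le> Suc i" "v \<in> layer E z i" for m v
    unfolding successively_conv_nth
  proof (intro allI impI)
    fix k assume "Suc k < length (map (\<lambda>k. (par ^^ k) v) [1..<m])"
    then show "E (map (\<lambda>k. (par ^^ k) v) [1..<m] ! k) (map (\<lambda>k. (par ^^ k) v) [1..<m] ! Suc k)"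
      using anc_edge[of "Suc k" v] that by simp
  qed
  have sE: "(\<lambda>x y. E y x) = E" using sym by (auto dest: sympD)
  have q: "successively E q" "q \<noteq> []" "hd q = par x'" "last q = (par ^^ Suc h) x'"
    unfolding q_def using succ_anc[of "Suc (Suc h)" x'] hi x' by (auto simp: hd_map last_map simp del: upt_Suc)
  have r: "successively E (rev r)"
    unfolding r_def successively_rev sE using succ_anc[of "Suc h" x] hi x by auto
  have r_ends: "hd r = par x" "last r = (par ^^ h) x" if "h > 0"
    using that unfolding r_def by (auto simp: hd_map last_map simp del: upt_Suc)
  have r_empty: "r = [] \<longleftrightarrow> h = 0" by (simp add: r_def)
  have same_level: "k = l" if "(par ^^ k) v = (par ^^ l) w" "k \<le> i" "l \<le> i"
      "v \<in> layer E z i" "w \<in> layer E z i" for k l v w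
    using layer_unique anc[of k v] anc[of l w] that by (metis diff_diff_cancel)
  have dq: "distinct q" "distinct r"
    unfolding q_def r_def distinct_map using x x' hi by (auto intro!: inj_onI dest: same_level simp del: upt_Suc funpow.simps)
  have pqr: "set p \<inter> (set q \<union> set r) = {}"
  proof -
    have "(par ^^ k) v \<notin> set p" if "1 \<le> k" "k \<le> Suc h" "v \<in> layer E z i" for k v
    proof
      assume "(par ^^ k) v \<in> set p"
      then have "(par ^^ k) v \<in> layer E z i \<or> (par ^^ k) v \<in> layer E z (Suc i)" using p(6) by blast
      moreover have "(par ^^ k) v \<in> layer E z (i - k)" using that hi by (intro anc) auto
      ultimately have "i - k = i \<or> i - k = Suc i" using layer_unique by metis
      then show False using that(1,2) hi by linarith
    qed
    then show ?thesis
      using x x' by (auto simp: q_def r_def simp del: upt_Suc funpow.simps)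
  qed
  \<comment> \<open>A common vertex would sit at the same height, at most \<open>h\<close>, on both
    tree paths, which would then agree at height \<open>h\<close>, against
    \<open>ne\<close>.\<close>
  have qr: "set q \<inter> set r = {}"
  proof -
    have "(par ^^ k) x' \<noteq> (par ^^ l) x" if kl: "k \<le> Suc h" "l \<le> h" for k l
    proof
      assume *: "(par ^^ k) x' = (par ^^ l) x"
      then have "k = l" using same_level kl hi x x' by auto
      then have "(par ^^ (h - l)) ((par ^^ l) x') = (par ^^ (h - l)) ((par ^^ l) x)" using * by simp
      then have "(par ^^ h) x' = (par ^^ h) x"
        using kl(2) by (simp flip: comp_apply[of "par ^^ _" "par ^^ _"] funpow_add)
      then show False using ne by simp
    qed
    moreover have "\<exists>k\<le>Suc h. v = (par ^^ k) x'" if "v \<in> set q" for v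
      using that by (auto simp: q_def less_Suc_eq_le simp del: upt_Suc funpow.simps)
    moreover have "\<exists>l\<le>h. v = (par ^^ l) x" if "v \<in> set r" for v
      using that by (auto simp: r_def less_Suc_eq_le simp del: upt_Suc funpow.simps)
    ultimately show ?thesis by (metis disjoint_iff)
  qed
  have "E x' (par x')" "E (par x) x"
    using anc_edge[of 0] x x' hi sym by (auto dest: sympD)
  have join: "E ((par ^^ Suc h) x') (hd (rev r))" if "h > 0"
  proof -
    have "E ((par ^^ h) x) (par ((par ^^ h) x))" using anc_edge[of h x] hi x by simp
    then show ?thesis using r_ends(2)[OF that] eq r_empty that sym by (auto simp: hd_rev dest: sympD)
  qed
  have "successively E (p @ q @ rev r)"
    using p q r join r_empty \<open>E x' (par x')\<close> by (auto simp: successively_append_iff)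
  moreover have "distinct (p @ q @ rev r)" using p(2) dq pqr qr by auto
  \<comment> \<open>For \<open>h = 0\<close> the list ends in the common ancestor, which is then the
    parent of \<open>x\<close>; otherwise it ends in the first vertex of \<open>r\<close>, again the
    parent of \<open>x\<close>.\<close>
  moreover have "E (last (p @ q @ rev r)) (hd (p @ q @ rev r))"
  proof (cases "h = 0")
    case True
    then show ?thesis using q p eq r_empty \<open>E (par x) x\<close> by simp
  next
    case False
    then show ?thesis using r_ends r_empty p \<open>E (par x) x\<close> by (simp add: last_rev)
  qed
  moreover have "length (p @ q @ rev r) = length p + 2 * h + 1" by (simp add: q_def r_def)
  ultimately show ?thesis unfolding has_cycle_def by metis
qed

text \<open>An ancestor map will serve as \<open>g\<close>. The path visits \<open>X\<close> at
  every second position, both ends included, and \<open>g\<close> is preserved from each visit to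
  the next.\<close>

lemma alternating_path_ends:
  assumes "\<And>u v. H u v \<Longrightarrow> (u \<in> X) \<noteq> (v \<in> X)"
    and "\<And>x y x'. H x y \<Longrightarrow> H y x' \<Longrightarrow> x \<in> X \<Longrightarrow> g x = g x'"
    and "successively H xs" "odd (length xs)" "hd xs \<in> X"
  shows "last xs \<in> X \<and> g (last xs) = g (hd xs)"
  using assms(3-5)
proof (induction xs rule: induct_list012)
  case (3 x y zs)
  then obtain z zs' where zs: "zs = z # zs'" by (cases zs) auto
  then have H: "H x y" "H y z" using 3 by auto
  then have "z \<in> X" "g x = g z" using assms(1)[of x y] assms(1)[of y z] assms(2)[of x y z] 3 by auto
  then show ?case using 3 zs by (auto simp: successively_Cons)
qed auto

text \<open>This limits how many vertices of a layer a path can block when a neighbour off the path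
  is sought.\<close>

lemma alternating_path_filter:
  assumes "\<And>u v. H u v \<Longrightarrow> (u \<in> X) \<noteq> (v \<in> X)"
    and "successively H xs" "even (length xs)"
  shows "2 * length (filter (\<lambda>v. v \<in> X) xs) = length xs"
  using assms(2,3)
proof (induction xs rule: induct_list012)
  case (3 x y zs)
  then show ?case using assms(1)[of x y] by (auto simp: successively_Cons)
qed auto

definition layer_edge :: "('a \<Rightarrow> 'a \<Rightarrow> bool) \<Rightarrow> 'a \<Rightarrow> nat \<Rightarrow> 'a \<Rightarrow> 'a \<Rightarrow> bool" where
  "layer_edge E z i u v \<longleftrightarrow> E u v \<and>
     (u \<in> layer E z i \<and> v \<in> layer E z (Suc i) \<or> u \<in> layer E z (Suc i) \<and> v \<in> layer E z i)"

lemma symp_layer_edge: "symp E \<Longrightarrow> symp (layer_edge E z i)"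
  by (auto simp: layer_edge_def intro!: sympI dest: sympD)

text \<open>In a subgraph of large minimum degree between two consecutive layers, the neighbours of a vertex
  of the outer layer share all their ancestors: were they to separate at some level, a path of a
  suitable length between two of them would close up through the tree to a cycle of length \<open>2 * t\<close>.\<close>

lemma degenerate_layer_edge:
  assumes sym: "symp E" and free: "\<not> has_cycle E (2 * t)" and "t \<ge> 2" and it: "i < t"
  shows "degenerate (layer_edge E z i) (real (2 * t - 2)) W"
  unfolding degenerate_def
proof (intro allI impI, rule ccontr)
  let ?H = "layer_edge E z i" and ?X = "layer E z i"
  fix U assume "U \<noteq> {}"
    and large: "\<not> (\<exists>v\<in>U. real (card {w \<in> U. ?H v w}) \<le> real (2 * t - 2))"
  have deg: "2 * t - 1 \<le> card {w \<in> U. ?H v w}" if "v \<in> U" for v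
  proof -
    have "2 * t - 2 < card {w \<in> U. ?H v w}" using large that by (auto simp flip: of_nat_le_iff)
    then show ?thesis by linarith
  qed
  have bip: "(u \<in> ?X) \<noteq> (v \<in> ?X)" if "?H u v" for u v
    using that layer_unique[of _ E z i "Suc i"] by (auto simp: layer_edge_def)
  have Hsym: "?H u v \<Longrightarrow> ?H v u" for u v using symp_layer_edge[OF sym] by (auto dest: sympD)
  have "\<exists>u. \<forall>l. v \<in> layer E z (Suc l) \<longrightarrow> u \<in> layer E z l \<and> E v u" for v
    using layer_SucE[of v E z] sym layer_unique[of v E z] by (metis sympD nat.inject)
  then obtain par where par: "\<And>l v. v \<in> layer E z (Suc l) \<Longrightarrow> par v \<in> layer E z l \<and> E v (par v)"
    by metis
  define HU where "HU u v \<longleftrightarrow> ?H u v \<and> u \<in> U \<and> v \<in> U" for u v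
  have HU_bip: "(u \<in> ?X) \<noteq> (v \<in> ?X)" if "HU u v" for u v using that bip by (simp add: HU_def)
  have HU_sym: "HU u v \<Longrightarrow> HU v u" for u v using Hsym by (auto simp: HU_def)
  have HU_ne: "u \<noteq> v" if "HU u v" for u v using HU_bip[OF that] by auto
  have nbrs: "{w \<in> U. ?H y w} = {w \<in> U. HU y w}" if "y \<in> U" for y
    using that by (auto simp: HU_def)
  \<comment> \<open>Downward induction on the height \<open>h\<close>: at \<open>h = i\<close> every
    ancestor is the root \<open>z\<close>, and at \<open>h = 0\<close> the two neighbours
    coincide.\<close>
  have "\<forall>y x x'. HU y x \<longrightarrow> HU y x' \<longrightarrow> x \<in> ?X \<longrightarrow> (par ^^ h) x = (par ^^ h) x'" if "h \<le> i" for h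
    using that
  proof (induction h rule: inc_induct)
    case base
    have anc0: "(par ^^ i) v = z" if "v \<in> layer E z i" for v i
      using that
    proof (induction i arbitrary: v)
      case (Suc i)
      then show ?case using par[of v i] by (simp add: funpow_swap1)
    qed simp
    show ?case
    proof (intro allI impI)
      fix y x x' assume "HU y x" "HU y x'" "x \<in> ?X"
      then have "x' \<in> ?X" using HU_bip by blast
      then show "(par ^^ i) x = (par ^^ i) x'" using anc0 \<open>x \<in> ?X\<close> by simp
    qed
  next
    case (step h)
    \<comment> \<open>The path below has \<open>2 * r + 1\<close> vertices and the tree supplies
      \<open>2 * h + 1\<close> more, \<open>2 * t\<close> in all; \<open>h < i < t\<close> gives
      \<open>r \<ge> 1\<close>.\<close>
    define r where "r = t - Suc h"
    have r: "r \<ge> 1" "r + h + 1 = t" using step.hyps it by (auto simp: r_def)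
    \<comment> \<open>The path \<open>w # P\<close> has an odd number of vertices, so by the
      induction hypothesis its ends agree at height \<open>Suc h\<close>. If they differed at height
      \<open>h\<close>, \<open>tree_path_cycle\<close> would apply.\<close>
    have last_anc: "(par ^^ h) w = (par ^^ h) (last P)"
      if P: "length P = 2 * r" "hd P = y" "successively HU P" "distinct P"
        and w: "HU y w" "w \<in> ?X" "w \<notin> set P" for P y w
    proof (rule ccontr)
      assume ne: "(par ^^ h) w \<noteq> (par ^^ h) (last P)"
      have "P \<noteq> []" using P(1) r(1) by auto
      have sP: "successively HU (w # P)"
        using P w HU_sym by (cases P) auto
      have ends: "last (w # P) \<in> ?X \<and> (par ^^ Suc h) (last (w # P)) = (par ^^ Suc h) (hd (w # P))"
      proof (rule alternating_path_ends[OF HU_bip _ sP])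
        show "(par ^^ Suc h) x = (par ^^ Suc h) x'" if "HU x y" "HU y x'" "x \<in> ?X" for x y x'
          using step.IH HU_sym that by blast
      qed (use P(1) w(2) in auto)
      have "has_cycle E (length (w # P) + 2 * h + 1)"
      proof (rule tree_path_cycle[OF sym par])
        show "successively E (w # P)"
          using sP by (rule successively_mono) (auto simp: HU_def layer_edge_def)
        have "set (w # P) \<subseteq> {v. \<exists>u. HU u v \<or> HU v u}"
        proof
          fix v assume "v \<in> set (w # P)"
          then obtain k where k: "k < length (w # P)" "(w # P) ! k = v" by (metis in_set_conv_nth)
          show "v \<in> {v. \<exists>u. HU u v \<or> HU v u}"
          proof (cases k)
            case 0
            then show ?thesis using k w(1) by auto
          next
            case (Suc k')
            then have "HU ((w # P) ! k') ((w # P) ! k)"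
              using sP k by (metis successively_conv_nth)
            then show ?thesis using k by auto
          qed
        qed
        then show "set (w # P) \<subseteq> ?X \<union> layer E z (Suc i)"
          by (fastforce simp: HU_def layer_edge_def)
      qed (use ends w P(4) \<open>P \<noteq> []\<close> ne step.hyps in auto)
      also have "length (w # P) + 2 * h + 1 = 2 * t" using P(1) r(2) by simp
      finally show False using free by simp
    qed
    \<comment> \<open>Degree \<open>2 * t - 1\<close> suffices to avoid one vertex, but at
      \<open>h = 0\<close> not two. So \<open>x\<close> and \<open>x'\<close> get a path each and
      are compared through a third neighbour \<open>w\<close> of \<open>y\<close> off both
      paths.\<close>
    have path: "\<exists>P. length P = 2 * r \<and> hd P = y \<and> successively HU P \<and> distinct P \<and> set P \<subseteq> U - {x}"
      if "y \<in> U" "y \<noteq> x" for y x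
    proof (rule exists_path_avoiding[where m = "2 * t - 1"])
      show "2 * t - 1 \<le> card {u \<in> U. HU v u}" if "v \<in> U" for v
        using deg[OF that] nbrs[OF that] by simp
    qed (use that r in auto)
    show ?case
    proof (intro allI impI)
      fix y x x' assume yx: "HU y x" and yx': "HU y x'" and x: "x \<in> ?X"
      then have x': "x' \<in> ?X" and y: "y \<in> U" using HU_bip by (blast, simp add: HU_def)
      obtain P where P: "length P = 2 * r" "hd P = y" "successively HU P" "distinct P" "x \<notin> set P"
        using path[OF y HU_ne[OF yx]] by blast
      obtain P' where P': "length P' = 2 * r" "hd P' = y" "successively HU P'" "distinct P'" "x' \<notin> set P'"
        using path[OF y HU_ne[OF yx']] by blast
      \<comment> \<open>All neighbours of \<open>y\<close> lie in \<open>?X\<close>, where each path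
        has at most \<open>r\<close> vertices; as \<open>2 * r < 2 * t - 1\<close>, a suitable
        \<open>w\<close> remains.\<close>
      have count: "card (set Q \<inter> ?X) \<le> r" if "length Q = 2 * r" "successively HU Q" for Q
      proof -
        have "card (set Q \<inter> ?X) = card (set (filter (\<lambda>v. v \<in> ?X) Q))" by (simp add: Int_def)
        also have "\<dots> \<le> length (filter (\<lambda>v. v \<in> ?X) Q)" by (rule card_length)
        finally show ?thesis using alternating_path_filter[OF HU_bip that(2)] that(1) by simp
      qed
      have "card ((set P \<inter> ?X) \<union> (set P' \<inter> ?X)) \<le> r + r"
        using card_Un_le count[OF P(1,3)] count[OF P'(1,3)] by (meson add_mono order_trans)
      also have "\<dots> < card {w \<in> U. HU y w}" using deg[OF y] nbrs[OF y] r by simp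
      finally have "\<not> {w \<in> U. HU y w} \<subseteq> (set P \<inter> ?X) \<union> (set P' \<inter> ?X)"
        using card_mono[of "(set P \<inter> ?X) \<union> (set P' \<inter> ?X)" "{w \<in> U. HU y w}"] by auto
      then obtain w where w: "HU y w" "w \<notin> (set P \<inter> ?X) \<union> (set P' \<inter> ?X)" by blast
      have "w \<in> ?X" using HU_bip[OF w(1)] HU_bip[OF yx] x by blast
      then have w': "w \<notin> set P" "w \<notin> set P'" using w(2) by auto
      have "(par ^^ h) x = (par ^^ h) (last P)" using last_anc[OF P(1-4) yx x P(5)] .
      also have "\<dots> = (par ^^ h) w" using last_anc[OF P(1-4) w(1) \<open>w \<in> ?X\<close> w'(1)] by simp
      also have "\<dots> = (par ^^ h) (last P')" using last_anc[OF P'(1-4) w(1) \<open>w \<in> ?X\<close> w'(2)] .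
      also have "\<dots> = (par ^^ h) x'" using last_anc[OF P'(1-4) yx' x' P'(5)] by simp
      finally show "(par ^^ h) x = (par ^^ h) x'" .
    qed
  qed
  from this[of 0] have same: "x = x'" if "HU y x" "HU y x'" "x \<in> ?X" for y x x' using that by auto
  obtain v where "v \<in> U" using \<open>U \<noteq> {}\<close> by blast
  have "\<exists>w. HU v w" if "v \<in> U" for v
    using deg[OF that] nbrs[OF that] \<open>t \<ge> 2\<close> by (cases "{w \<in> U. HU v w} = {}") auto
  then obtain w where "HU v w" using \<open>v \<in> U\<close> by blast
  then obtain y x where yx: "HU y x" "x \<in> ?X" using HU_bip HU_sym by metis
  have "{w \<in> U. HU y w} \<subseteq> {x}" using same yx by blast
  then have "card {w \<in> U. HU y w} \<le> 1" using card_mono[of "{x}"] by fastforce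
  moreover have "y \<in> U" using yx by (simp add: HU_def)
  ultimately show False using deg[of y] nbrs[of y] \<open>t \<ge> 2\<close> by auto
qed

section \<open>Degeneracy of graphs without a cycle of length 2t\<close>

text \<open>If all degrees exceeded the bound, each layer up to depth \<open>t\<close> would be more
  than \<open>N\<close> times as large as the one before, and layer \<open>t\<close> would have more
  than \<open>N ^ t = card U\<close> vertices.\<close>

lemma exists_low_degree_bipartite:
  assumes sym: "symp E" and U: "finite U" "U \<noteq> {}" and EU: "\<And>u v. E u v \<Longrightarrow> v \<in> U"
    and bip: "\<And>u v. E u v \<Longrightarrow> (u \<in> S) \<noteq> (v \<in> S)"
    and free: "\<not> has_cycle E (2 * t)" and t: "t \<ge> 2"
  shows "\<exists>v\<in>U. real (card {u. E v u}) \<le> real (2 * t - 2) * (real (card U) powr (1 / real t) + 3)"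
proof (rule ccontr)
  define N where "N = real (card U) powr (1 / real t)"
  define s where "s = real (2 * t - 2)"
  have "s > 0" using t by (simp add: s_def)
  have "card U \<ge> 1" using U by (simp add: Suc_le_eq card_gt_0_iff)
  then have N: "N \<ge> 1" "N ^ t = real (card U)"
    using t by (auto simp: N_def ge_one_powr_ge_zero powr_realpow[symmetric] powr_powr)
  assume "\<not> ?thesis"
  then have deg: "s * (N + 3) < real (card {u. E v u})" if "v \<in> U" for v
    using that by (auto simp: N_def s_def not_le)
  have finE: "finite {u. E v u}" for v using EU by (auto intro: finite_subset[OF _ U(1)])
  define \<delta> where "\<delta> = Min ((\<lambda>v. real (card {u. E v u})) ` U)"
  have \<delta>: "\<delta> \<le> real (card {u. E v u})" if "v \<in> U" for v
    using U that by (simp add: \<delta>_def)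
  have "s * (N + 3) < \<delta>" using U deg by (simp add: \<delta>_def)
  \<comment> \<open>\<open>\<rho>\<close> is the growth factor: the edge counts at layer
    \<open>Suc i\<close> involve \<open>?L (Suc i)\<close> twice and \<open>?L i\<close> once, which
    costs 3.\<close>
  define \<rho> where "\<rho> = \<delta> / s - 3"
  have \<rho>: "\<delta> = s * (\<rho> + 3)" "N < \<rho>"
    using \<open>s > 0\<close> \<open>s * (N + 3) < \<delta>\<close> by (auto simp: \<rho>_def field_simps)
  obtain z where "z \<in> U" using U by blast
  have LU: "layer E z i \<subseteq> U" for i
  proof (cases i)
    case (Suc j)
    then show ?thesis using EU layer_SucE[of _ E z j] by blast
  qed (use \<open>z \<in> U\<close> in auto)
  have finL: "finite (layer E z i)" for i using LU U(1) by (rule finite_subset)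
  let ?L = "\<lambda>i. real (card (layer E z i))"
  have disj: "layer E z i \<inter> layer E z (Suc i) = {}" for i using layer_unique[of _ E z i "Suc i"] by auto
  have out: "real (card {(a, b). a \<in> layer E z i \<and> b \<in> layer E z (Suc i) \<and> E a b}) \<le> s * (?L i + ?L (Suc i))"
    and inn: "real (card {(a, b). a \<in> layer E z (Suc i) \<and> b \<in> layer E z i \<and> E a b}) \<le> s * (?L i + ?L (Suc i))"
    if "i < t" for i
  proof -
    let ?W = "layer E z i \<union> layer E z (Suc i)"
    have fin: "finite ?W" using finL by simp
    note degen = degenerate_layer_edge[OF sym free t that, of z ?W]
    have "card ?W = card (layer E z i) + card (layer E z (Suc i))"
      using finL disj by (intro card_Un_disjoint) auto
    then have W: "s * real (card ?W) = s * (?L i + ?L (Suc i))" by simp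
    have "{(a, b). a \<in> layer E z i \<and> b \<in> layer E z (Suc i) \<and> E a b} =
      {(a, b). a \<in> ?W \<inter> layer E z i \<and> b \<in> ?W \<inter> layer E z (Suc i) \<and> layer_edge E z i a b}"
      by (auto simp: layer_edge_def)
    then show "real (card {(a, b). a \<in> layer E z i \<and> b \<in> layer E z (Suc i) \<and> E a b}) \<le> s * (?L i + ?L (Suc i))"
      using degenerate_card_arcs_le[OF fin degen symp_layer_edge[OF sym] disj[of i]] W
      unfolding s_def by (simp only:)
    have "{(a, b). a \<in> layer E z (Suc i) \<and> b \<in> layer E z i \<and> E a b} =
      {(a, b). a \<in> ?W \<inter> layer E z (Suc i) \<and> b \<in> ?W \<inter> layer E z i \<and> layer_edge E z i a b}"
      by (auto simp: layer_edge_def)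
    then show "real (card {(a, b). a \<in> layer E z (Suc i) \<and> b \<in> layer E z i \<and> E a b}) \<le> s * (?L i + ?L (Suc i))"
      using degenerate_card_arcs_le[OF fin degen symp_layer_edge[OF sym], of "layer E z (Suc i)" "layer E z i"]
        disj[of i] W unfolding s_def by (simp only: Int_commute)
  qed
  have degree_sum: "\<delta> * ?L i \<le> real (card {(a, b). a \<in> layer E z i \<and> E a b})" for i
  proof -
    have "\<delta> * ?L i = (\<Sum>v\<in>layer E z i. \<delta>)" by simp
    also have "\<dots> \<le> (\<Sum>v\<in>layer E z i. real (card {u. E v u}))"
      using \<delta> LU by (intro sum_mono) auto
    also have "\<dots> = real (card (SIGMA v:layer E z i. {u. E v u}))"
      using finL finE by (subst card_SigmaI) auto
    also have "(SIGMA v:layer E z i. {u. E v u}) = {(a, b). a \<in> layer E z i \<and> E a b}" by auto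
    finally show ?thesis .
  qed
  \<comment> \<open>Monotonicity is carried along to absorb \<open>?L i\<close>, which comes from
    the edges leading back, into \<open>?L (Suc i)\<close>.\<close>
  have growth: "\<rho> * ?L i \<le> ?L (Suc i) \<and> ?L i \<le> ?L (Suc i)" if "i < t" for i
    using that
  proof (induction i)
    case 0
    have "{(a, b). a \<in> layer E z 0 \<and> E a b} \<subseteq> {(a, b). a \<in> layer E z 0 \<and> b \<in> layer E z (Suc 0) \<and> E a b}"
      using layer_step_bipartite[OF sym bip, of _ z 0] by blast
    then have "card {(a, b). a \<in> layer E z 0 \<and> E a b} \<le> card \<dots>"
      by (intro card_mono finite_subset[OF _ finite_cartesian_product[OF finL finL], of _ 0 "Suc 0"]) auto
    then have "\<delta> * ?L 0 \<le> s * (?L 0 + ?L (Suc 0))" using degree_sum[of 0] out[OF 0] by linarith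
    then have "s * (\<rho> + 3) \<le> s * (1 + ?L (Suc 0))" using \<rho>(1) by simp
    then have "\<rho> + 3 \<le> 1 + ?L (Suc 0)" using \<open>s > 0\<close> by (simp only: mult_le_cancel_left_pos)
    then show ?case using N(1) \<rho>(2) by simp
  next
    case (Suc i)
    let ?P = "{(a, b). a \<in> layer E z (Suc i) \<and> b \<in> layer E z (Suc (Suc i)) \<and> E a b}"
    let ?Q = "{(a, b). a \<in> layer E z (Suc i) \<and> b \<in> layer E z i \<and> E a b}"
    have "{(a, b). a \<in> layer E z (Suc i) \<and> E a b} \<subseteq> ?P \<union> ?Q"
      using layer_step_bipartite[OF sym bip, of _ z "Suc i"] by blast
    moreover have "finite (?P \<union> ?Q)"
      by (rule finite_subset[of _ "layer E z (Suc i) \<times> (layer E z (Suc (Suc i)) \<union> layer E z i)"])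
        (use finL in auto)
    ultimately have "card {(a, b). a \<in> layer E z (Suc i) \<and> E a b} \<le> card (?P \<union> ?Q)"
      by (intro card_mono)
    also have "\<dots> \<le> card ?P + card ?Q" by (rule card_Un_le)
    finally have "card {(a, b). a \<in> layer E z (Suc i) \<and> E a b} \<le> card ?P + card ?Q" .
    then have "\<delta> * ?L (Suc i) \<le> s * (?L (Suc i) + ?L (Suc (Suc i))) + s * (?L i + ?L (Suc i))"
      using degree_sum[of "Suc i"] out[OF Suc.prems] inn[of i] Suc.prems by linarith
    also have "\<dots> \<le> s * (?L (Suc (Suc i)) + 3 * ?L (Suc i))"
      using Suc \<open>s > 0\<close> by (simp flip: distrib_left)
    finally have "(\<rho> + 3) * ?L (Suc i) \<le> ?L (Suc (Suc i)) + 3 * ?L (Suc i)"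
      using \<open>s > 0\<close> \<rho>(1) by (simp only: mult.assoc mult_le_cancel_left_pos)
    then have *: "\<rho> * ?L (Suc i) \<le> ?L (Suc (Suc i))" by (simp add: algebra_simps)
    have "?L (Suc i) \<le> \<rho> * ?L (Suc i)" using N(1) \<rho>(2) by (simp add: mult_le_cancel_right1)
    with * show ?case by linarith
  qed
  have power: "\<rho> ^ i \<le> ?L i" if "i \<le> t" for i
    using that
  proof (induction i)
    case (Suc i)
    then have "\<rho> * \<rho> ^ i \<le> \<rho> * ?L i" using N(1) \<rho>(2) by (intro mult_left_mono) auto
    then show ?case using growth[of i] Suc.prems by simp
  qed simp
  have "N ^ t < \<rho> ^ t" using N(1) \<rho>(2) t by (intro power_strict_mono) auto
  also have "\<dots> \<le> ?L t" using power by simp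
  also have "\<dots> \<le> real (card U)" using card_mono[OF U(1) LU] by simp
  finally show False using N(2) by simp
qed

lemma degenerate_even_cycle_free:
  assumes sym: "symp E" and irr: "irreflp E" and W: "finite W"
    and free: "\<not> has_cycle E (2 * t)" and t: "t \<ge> 2"
  shows "degenerate E (16 * (real t - 1) * real (card W) powr (1 / real t)) W"
  unfolding degenerate_def
proof (intro allI impI)
  fix U assume U: "U \<subseteq> W" "U \<noteq> {}"
  then have finU: "finite U" using W finite_subset by blast
  obtain S where S: "\<And>v. v \<in> U \<Longrightarrow> card {u \<in> U. E v u} \<le> 2 * card {u \<in> U. E v u \<and> (u \<in> S) \<noteq> (v \<in> S)}"
    using exists_cut_half_degrees[OF finU sym irr] by blast
  define H where "H u v \<longleftrightarrow> E u v \<and> u \<in> U \<and> v \<in> U \<and> (u \<in> S) \<noteq> (v \<in> S)" for u v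
  have "\<exists>v\<in>U. real (card {u. H v u}) \<le> real (2 * t - 2) * (real (card U) powr (1 / real t) + 3)"
  proof (rule exists_low_degree_bipartite[OF _ finU U(2) _ _ _ t])
    show "symp H" using sym by (auto simp: H_def intro!: sympI dest: sympD)
    show "\<not> has_cycle H (2 * t)" using free has_cycle_mono[of H _ E] by (auto simp: H_def le_fun_def)
  qed (auto simp: H_def)
  then obtain v where v: "v \<in> U" "real (card {u. H v u}) \<le> real (2 * t - 2) * (real (card U) powr (1 / real t) + 3)"
    by blast
  have "{u. H v u} = {u \<in> U. E v u \<and> (u \<in> S) \<noteq> (v \<in> S)}" using v(1) by (auto simp: H_def)
  then have "real (card {u \<in> U. E v u}) \<le> 2 * real (card {u. H v u})"
    using S[OF v(1)] by (simp flip: of_nat_le_iff)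
  also have "\<dots> \<le> 2 * (real (2 * t - 2) * (real (card U) powr (1 / real t) + 3))" using v(2) by simp
  \<comment> \<open>As the power of \<open>card W\<close> is at least 1, adding 3 at most quadruples
    it. The constant is \<open>16 = 2 * 2 * 4\<close>: the cut,
    \<open>2 * t - 2 = 2 * (t - 1)\<close>, and this 4.\<close>
  also have "\<dots> \<le> 2 * (real (2 * t - 2) * (4 * real (card W) powr (1 / real t)))"
  proof -
    have cUW: "card U \<le> card W" and "card U \<ge> 1"
      using U finU W by (auto simp: card_mono Suc_le_eq card_gt_0_iff)
    then have "real (card U) powr (1 / real t) \<le> real (card W) powr (1 / real t)"
      by (intro powr_mono2) auto
    moreover have "1 \<le> real (card W) powr (1 / real t)"
      using cUW \<open>card U \<ge> 1\<close> by (intro ge_one_powr_ge_zero) auto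
    ultimately show ?thesis by (intro mult_left_mono) auto
  qed
  also have "\<dots> = 16 * (real t - 1) * real (card W) powr (1 / real t)"
    using t by (simp add: of_nat_diff algebra_simps)
  finally show "\<exists>v\<in>U. real (card {u \<in> U. E v u}) \<le> 16 * (real t - 1) * real (card W) powr (1 / real t)"
    using v(1) by blast
qed

section \<open>Orthonormal representations and spectra\<close>

text \<open>Subtracting from \<open>x\<close> its component along \<open>f w\<close> lowers the
  squared length by \<open>(x \<bullet> f w)\<^sup>2\<close> and keeps the inner products with the
  other vectors.\<close>

lemma bessel_inequality_vec:
  fixes f :: "'a \<Rightarrow> real vec"
  assumes "finite I" "x \<in> carrier_vec d"
    and "\<And>v. v \<in> I \<Longrightarrow> f v \<in> carrier_vec d" "\<And>v. v \<in> I \<Longrightarrow> f v \<bullet> f v = 1"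
    and "\<And>u v. u \<in> I \<Longrightarrow> v \<in> I \<Longrightarrow> u \<noteq> v \<Longrightarrow> f u \<bullet> f v = 0"
  shows "(\<Sum>v\<in>I. (x \<bullet> f v)\<^sup>2) \<le> x \<bullet> x"
  using assms
proof (induction arbitrary: x rule: finite_induct)
  case empty
  then show ?case by (simp add: scalar_prod_def sum_nonneg)
next
  case (insert w I)
  have w: "f w \<in> carrier_vec d" and x: "x \<in> carrier_vec d" using insert.prems by auto
  define y where "y = x - (x \<bullet> f w) \<cdot>\<^sub>v f w"
  have y: "y \<in> carrier_vec d" using w x by (simp add: y_def)
  have yv: "y \<bullet> f v = x \<bullet> f v" if "v \<in> I" for v
  proof -
    have "w \<noteq> v" using insert.hyps(2) that by blast
    then have v: "f v \<in> carrier_vec d" "f w \<bullet> f v = 0" using insert.prems that by auto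
    then show ?thesis using w x by (simp add: y_def minus_scalar_prod_distrib[of _ d])
  qed
  have yw: "y \<bullet> f w = 0"
    using w x insert.prems(3)[of w] by (simp add: y_def minus_scalar_prod_distrib[of _ d])
  have "y \<bullet> y = y \<bullet> x - (x \<bullet> f w) * (y \<bullet> f w)"
    using w x y by (subst (2) y_def) (simp add: scalar_prod_minus_distrib[of _ d])
  also have "\<dots> = x \<bullet> x - (x \<bullet> f w)\<^sup>2"
    using w x yw comm_scalar_prod[OF w x]
    by (simp add: y_def minus_scalar_prod_distrib[of _ d] power2_eq_square)
  finally have "y \<bullet> y = x \<bullet> x - (x \<bullet> f w)\<^sup>2" .
  moreover have "(\<Sum>v\<in>I. (y \<bullet> f v)\<^sup>2) \<le> y \<bullet> y"
    using insert.prems y by (intro insert.IH) auto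
  ultimately show ?case using insert.hyps yv by simp
qed

lemma sum_inner_sq_coloured_le:
  fixes f :: "'a \<Rightarrow> real vec" and c :: "'a \<Rightarrow> nat"
  assumes "finite I" "x \<in> carrier_vec d" "x \<bullet> x = 1" "c ` I \<subseteq> {..k}"
    and "\<And>v. v \<in> I \<Longrightarrow> f v \<in> carrier_vec d" "\<And>v. v \<in> I \<Longrightarrow> f v \<bullet> f v = 1"
    and "\<And>u v. u \<in> I \<Longrightarrow> v \<in> I \<Longrightarrow> u \<noteq> v \<Longrightarrow> c u = c v \<Longrightarrow> f u \<bullet> f v = 0"
  shows "(\<Sum>v\<in>I. (x \<bullet> f v)\<^sup>2) \<le> real (k + 1)"
proof -
  have "(\<Sum>v\<in>I. (x \<bullet> f v)\<^sup>2) = (\<Sum>j\<in>{..k}. \<Sum>v\<in>{v\<in>I. c v = j}. (x \<bullet> f v)\<^sup>2)"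
    using assms(1,4) by (intro sum.group[symmetric]) auto
  also have "\<dots> \<le> (\<Sum>j\<in>{..k}. 1)"
  proof (intro sum_mono)
    fix j
    have "(\<Sum>v\<in>{v\<in>I. c v = j}. (x \<bullet> f v)\<^sup>2) \<le> x \<bullet> x"
      by (rule bessel_inequality_vec[of _ x d]) (use assms in auto)
    then show "(\<Sum>v\<in>{v\<in>I. c v = j}. (x \<bullet> f v)\<^sup>2) \<le> 1" using assms(3) by simp
  qed
  finally show ?thesis by simp
qed

section \<open>From forbidden subgraphs to vertex lists\<close>

lemma not_has_cycle_if_free:
  assumes G: "pair_graph G" and free: "is_free (cycle_graph k) G" and k: "k \<ge> 3"
  shows "\<not> has_cycle (\<lambda>u v. (u, v) \<in> parcs G) k"
proof
  interpret pair_graph G by fact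
  assume "has_cycle (\<lambda>u v. (u, v) \<in> parcs G) k"
  then obtain p where p: "length p = k" "distinct p" "successively (\<lambda>u v. (u, v) \<in> parcs G) p"
    "(last p, hd p) \<in> parcs G" unfolding has_cycle_def by blast
  have step: "(p ! i, p ! (Suc i mod k)) \<in> parcs G" if "i < k" for i
  proof (cases "Suc i = k")
    case True
    then have "p ! i = last p" "p ! (Suc i mod k) = hd p"
      using p(1) k last_conv_nth[of p] hd_conv_nth[of p] by force+
    then show ?thesis using p(4) by simp
  next
    case False
    then show ?thesis using p that by (auto simp: successively_conv_nth)
  qed
  have sym: "(u, v) \<in> parcs G \<Longrightarrow> (v, u) \<in> parcs G" for u v
    using sym_arcs by (auto simp: symmetric_def dest: symD)
  define g where "g = map_prod ((!) p) ((!) p)"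
  define K where "K = \<lparr> pverts = set p, parcs = g ` parcs (cycle_graph k) \<rparr>"
  have arcs: "parcs K \<subseteq> parcs G"
    using step sym by (auto simp: K_def g_def cycle_graph_def)
  have verts: "pverts K \<subseteq> pverts G"
  proof
    fix v assume "v \<in> pverts K"
    then obtain i where "i < k" "v = p ! i" using p(1) by (auto simp: K_def in_set_conv_nth)
    then show "v \<in> pverts G" using step[of i] in_arcsD1 by auto
  qed
  have wfK: "wf_digraph (with_proj K)"
    by unfold_locales (use p(1) in \<open>auto simp: K_def g_def cycle_graph_def\<close>)
  have "subgraph (with_proj K) (with_proj G)"
    unfolding subgraph_def using verts arcs wfK wf_digraph by (auto simp: compatible_def)
  moreover have "digraph_iso (with_proj K) (with_proj (cycle_graph k))"
  proof -
    define q where "q = the_inv_into {..<k} ((!) p)"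
    have inj: "inj_on ((!) p) {..<k}" using p(1,2) by (auto simp: inj_on_def nth_eq_iff_index_eq)
    have q: "q (p ! i) = i" if "i < k" for i using the_inv_into_f_f[OF inj] that by (simp add: q_def)
    have qp: "p ! (q v) = v" if "v \<in> set p" for v
      using that q p(1) by (metis in_set_conv_nth)
    \<comment> \<open>The isomorphism has to run from the subgraph to the cycle, hence the inverse
      \<open>q\<close> of the map from positions to vertices.\<close>
    define F where "F = \<lparr> iso_verts = q, iso_arcs = map_prod q q, iso_head = snd, iso_tail = fst \<rparr>"
    have gq: "map_prod q q (g a) = a" if "a \<in> parcs (cycle_graph k)" for a
      using that q by (auto simp: g_def cycle_graph_def)
    have "pre_digraph.digraph_isomorphism (with_proj K) F"
      unfolding pre_digraph.digraph_isomorphism_def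
    proof (intro conjI ballI)
      show "inj_on (iso_verts F) (verts (with_proj K))"
        by (rule inj_on_inverseI[of _ "(!) p"]) (simp add: F_def K_def qp)
      show "inj_on (iso_arcs F) (arcs (with_proj K))"
        by (rule inj_on_inverseI[of _ g]) (auto simp: F_def K_def gq)
    qed (use wfK in \<open>auto simp: F_def\<close>)
    moreover have "with_proj (cycle_graph k) = app_iso F (with_proj K)"
    proof -
      have "q ` set p = {..<k}" using q p(1) by (force simp: set_conv_nth image_iff)
      moreover have "map_prod q q ` g ` parcs (cycle_graph k) = parcs (cycle_graph k)"
        unfolding image_image using gq by (simp cong: image_cong)
      ultimately show ?thesis
        by (simp add: app_iso_def F_def K_def with_proj_def cycle_graph_def)
    qed
    ultimately show ?thesis unfolding digraph_iso_def by blast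
  qed
  ultimately show False using free unfolding is_free_def by blast
qed

text \<open>\<open>Max\<close> says nothing about an empty set, so a real eigenvalue must be
  exhibited. A complex one exists, and symmetry forces it to be real.\<close>

lemma spectrum_real_symmetric_nonempty:
  fixes A :: "real mat"
  assumes A: "A \<in> carrier_mat n n" and n: "n > 0"
    and sym: "\<And>i j. i < n \<Longrightarrow> j < n \<Longrightarrow> A $$ (i, j) = A $$ (j, i)"
  shows "spectrum A \<noteq> {}"
proof -
  let ?B = "map_mat complex_of_real A"
  have B: "?B \<in> carrier_mat n n" using A by simp
  obtain k where "eigenvalue ?B k"
    using spectrum_non_empty[OF B n] by (auto simp: spectrum_def)
  then obtain v where "eigenvector ?B v k" by (auto simp: eigenvalue_def)
  then have v: "v \<in> carrier_vec n" "v \<noteq> 0\<^sub>v n" "?B *\<^sub>v v = k \<cdot>\<^sub>v v"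
    using A by (auto simp: eigenvector_def)
  have row: "(\<Sum>j<n. of_real (A $$ (i, j)) * v $ j) = k * v $ i" if "i < n" for i
  proof -
    have "(?B *\<^sub>v v) $ i = (\<Sum>j<n. of_real (A $$ (i, j)) * v $ j)"
      using A v(1) that by (simp add: scalar_prod_def atLeast0LessThan)
    then show ?thesis using v that by simp
  qed
  define r where "r = (\<Sum>i<n. (cmod (v $ i))\<^sup>2)"
  have r: "complex_of_real r = (\<Sum>i<n. cnj (v $ i) * v $ i)"
    unfolding r_def of_real_sum by (intro sum.cong refl) (simp only: complex_norm_square mult.commute)
  have "r \<noteq> 0"
  proof
    assume "r = 0"
    then have "v $ i = 0" if "i < n" for i
      using that by (auto simp: r_def sum_nonneg_eq_0_iff)
    then have "v = 0\<^sub>v n" using v(1) by auto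
    then show False using v(2) by simp
  qed
  \<comment> \<open>The Hermitian form of \<open>A\<close> at \<open>v\<close> is \<open>k\<close>
    times the squared norm \<open>r\<close>; it equals its own conjugate, so \<open>k\<close> does
    too.\<close>
  have "k * of_real r = (\<Sum>i<n. \<Sum>j<n. cnj (v $ i) * (of_real (A $$ (i, j)) * v $ j))"
    unfolding r sum_distrib_left[symmetric] using row by (simp add: sum_distrib_left mult_ac)
  moreover have "cnj (\<Sum>i<n. \<Sum>j<n. cnj (v $ i) * (of_real (A $$ (i, j)) * v $ j))
    = (\<Sum>i<n. \<Sum>j<n. cnj (v $ i) * (of_real (A $$ (i, j)) * v $ j))"
    unfolding cnj_sum by (subst sum.swap, intro sum.cong refl) (simp add: sym mult_ac)
  ultimately have "cnj k * of_real r = k * of_real r" by (metis complex_cnj_complex_of_real complex_cnj_mult)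
  then have "cnj k = k" using \<open>r \<noteq> 0\<close> by simp
  then have k: "k = of_real (Re k)" by (simp add: complex_eq_iff)
  have "poly (char_poly ?B) k = 0" using \<open>eigenvalue ?B k\<close> eigenvalue_root_char_poly[OF B] by simp
  then have "poly (map_poly complex_of_real (char_poly A)) (of_real (Re k)) = 0"
    using of_real_hom.char_poly_hom[OF A] k by metis
  then have "poly (char_poly A) (Re k) = 0" by (simp add: of_real_hom.poly_map_poly)
  then have "eigenvalue A (Re k)" using eigenvalue_root_char_poly[OF A] by simp
  then show ?thesis by (auto simp: spectrum_def)
qed

section \<open>Assembling the eigenvalue bound\<close>

lemma gram_quadratic_form_le:
  fixes G :: "nat pair_pre_digraph" and a :: "nat \<Rightarrow> real"
  assumes G: "pair_graph G" and V: "pverts G = {..<n}" and n: "n \<ge> 1" and t: "t \<ge> 2"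
    and free: "\<not> has_cycle (\<lambda>u v. (u, v) \<in> parcs G) (2 * t)"
    and f: "orthonormal_rep G d f"
  shows "(\<Sum>u<n. \<Sum>v<n. a u * a v * (f u \<bullet> f v))
    \<le> 12 * real t * real n powr (1 / (2 * real t)) * (\<Sum>u<n. (a u)\<^sup>2)"
proof -
  interpret pair_graph G by fact
  let ?E = "\<lambda>u v. (u, v) \<in> parcs G"
  \<comment> \<open>Symmetry is required at all arguments, but the scalar product is known to
    commute only for vectors of equal dimension; hence the value 0 off the vertex set.\<close>
  define M where "M u v = (if u < n \<and> v < n then f u \<bullet> f v else 0)" for u v
  define q where "q = real n powr (1 / (2 * real t))"
  have q1: "q \<ge> 1" using n by (simp add: q_def ge_one_powr_ge_zero)
  have q2: "q\<^sup>2 = real n powr (1 / real t)"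
    by (simp add: q_def power2_eq_square flip: powr_add)
  have symE: "symp ?E" using sym_arcs by (auto simp: symmetric_def intro!: sympI dest: symD)
  have irr: "irreflp ?E" using no_loops' by (auto intro!: irreflpI)
  have inV: "u < n \<and> v < n" if "?E u v" for u v
    using that in_arcsD1 in_arcsD2 V by auto
  have fc: "f u \<in> carrier_vec d" "f u \<bullet> f u = 1" if "u < n" for u
    using f V that by (auto simp: orthonormal_rep_def)
  have orth: "f u \<bullet> f v = 0" if "u < n" "v < n" "u \<noteq> v" "\<not> ?E u v" for u v
    using f V that by (auto simp: orthonormal_rep_def)
  have Msym: "M u v = M v u" for u v
    using comm_scalar_prod[of "f u" d "f v"] fc by (auto simp: M_def)
  have degen: "degenerate ?E (16 * (real t - 1) * q\<^sup>2) {..<n}"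
    using degenerate_even_cycle_free[OF symE irr _ free t, of "{..<n}"] q2 by simp
  have nbr: "(\<Sum>v\<in>{v\<in>{..<n}. ?E u v}. (M u v)\<^sup>2) \<le> 2 * real t - 1" if u: "u < n" for u
  proof -
    let ?I = "{v\<in>{..<n}. ?E u v}"
    have "degenerate ?E (real (2 * t - 2)) ?I"
      using degenerate_neighbourhood[OF symE irr free t, of u] by (rule degenerate_subset) auto
    then obtain c :: "nat \<Rightarrow> nat" where c: "c ` ?I \<subseteq> {..2 * t - 2}"
      "\<And>v w. v \<in> ?I \<Longrightarrow> w \<in> ?I \<Longrightarrow> v \<noteq> w \<Longrightarrow> ?E v w \<Longrightarrow> c v \<noteq> c w"
      using degenerate_colouring[OF _ _ symE, of ?I "2 * t - 2"] by auto
    have "(\<Sum>v\<in>?I. (f u \<bullet> f v)\<^sup>2) \<le> real (2 * t - 2 + 1)"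
    proof (rule sum_inner_sq_coloured_le[OF _ _ _ c(1)])
      show "f v \<bullet> f w = 0" if "v \<in> ?I" "w \<in> ?I" "v \<noteq> w" "c v = c w" for v w
        using c(2)[OF that(1-3)] orth[of v w] that by auto
    qed (use fc u in auto)
    also have "real (2 * t - 2 + 1) = 2 * real t - 1" using t by (simp add: of_nat_diff)
    finally show ?thesis using u by (simp add: M_def)
  qed
  \<comment> \<open>The best \<open>c\<close> balances \<open>c * d\<close> against
    \<open>K / c\<close>; for large \<open>t\<close> it is about \<open>1 / (sqrt 8 * q)\<close>,
    and 3 replaces \<open>sqrt 8\<close>.\<close>
  define c where "c = 1 / (3 * q)"
  have c: "c > 0" using q1 by (simp add: c_def)
  let ?A = "\<Sum>u<n. (a u)\<^sup>2"
  have "(\<Sum>u<n. \<Sum>v<n. a u * a v * (f u \<bullet> f v))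
    = (\<Sum>u<n. (a u)\<^sup>2 + (\<Sum>v\<in>{v\<in>{..<n}. ?E u v}. a u * a v * M u v))"
  proof (intro sum.cong refl)
    fix u assume "u \<in> {..<n}"
    then have u: "u < n" by simp
    let ?I = "{v\<in>{..<n}. ?E u v}"
    have "u \<notin> ?I" using irr by (auto dest: irreflpD)
    have "(\<Sum>v<n. a u * a v * (f u \<bullet> f v)) = (\<Sum>v\<in>insert u ?I. a u * a v * (f u \<bullet> f v))"
      using orth[OF u] u by (intro sum.mono_neutral_right) auto
    also have "\<dots> = a u * a u * (f u \<bullet> f u) + (\<Sum>v\<in>?I. a u * a v * (f u \<bullet> f v))"
      using \<open>u \<notin> ?I\<close> by (intro sum.insert) auto
    also have "\<dots> = (a u)\<^sup>2 + (\<Sum>v\<in>?I. a u * a v * M u v)"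
      using u fc by (simp add: M_def power2_eq_square)
    finally show "(\<Sum>v<n. a u * a v * (f u \<bullet> f v)) = (a u)\<^sup>2 + (\<Sum>v\<in>?I. a u * a v * M u v)" .
  qed
  also have "\<dots> = ?A + (\<Sum>u<n. \<Sum>v\<in>{v\<in>{..<n}. ?E u v}. a u * a v * M u v)"
    by (rule sum.distrib)
  also have "\<dots> \<le> ?A + (c * (16 * (real t - 1) * q\<^sup>2) * ?A
      + (\<Sum>v<n. (a v)\<^sup>2 * (\<Sum>u\<in>{u\<in>{..<n}. ?E v u}. (M v u)\<^sup>2)) / c)"
    using degenerate_quadratic_form_le[OF _ degen symE irr Msym c, of a] by simp
  also have "\<dots> \<le> ?A + (c * (16 * (real t - 1) * q\<^sup>2) * ?A
      + (\<Sum>v<n. (a v)\<^sup>2 * (2 * real t - 1)) / c)"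
    using nbr c by (intro add_left_mono divide_right_mono sum_mono mult_left_mono) auto
  also have "\<dots> = (1 + c * (16 * (real t - 1) * q\<^sup>2) + (2 * real t - 1) / c) * ?A"
    by (simp add: algebra_simps sum_distrib_left add_divide_distrib)
  also have "1 + c * (16 * (real t - 1) * q\<^sup>2) + (2 * real t - 1) / c
    = 1 + (16 / 3 * (real t - 1) + 3 * (2 * real t - 1)) * q"
    using q1 by (simp add: c_def field_simps power2_eq_square)
  also have "\<dots> * ?A \<le> 12 * real t * q * ?A"
  proof (intro mult_right_mono sum_nonneg)
    \<comment> \<open>Since \<open>q \<ge> 1\<close>, the diagonal contribution 1 is absorbed as
      well; the total coefficient of \<open>q\<close> is \<open>(34 * t - 22) / 3\<close>.\<close>
    have "1 + (16 / 3 * (real t - 1) + 3 * (2 * real t - 1)) * q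
      \<le> q + (16 / 3 * (real t - 1) + 3 * (2 * real t - 1)) * q" using q1 by simp
    also have "\<dots> = (1 + 16 / 3 * (real t - 1) + 3 * (2 * real t - 1)) * q" by (simp add: algebra_simps)
    also have "\<dots> \<le> 12 * real t * q"
    proof (rule mult_right_mono)
      show "1 + 16 / 3 * (real t - 1) + 3 * (2 * real t - 1) \<le> 12 * real t"
        by (simp add: field_simps)
    qed (use q1 in simp)
    finally show "1 + (16 / 3 * (real t - 1) + 3 * (2 * real t - 1)) * q \<le> 12 * real t * q" .
  qed simp
  finally show ?thesis by (simp add: q_def)
qed

text \<open>At an eigenvector the form equals the eigenvalue times the squared norm, which is
  positive.\<close>

lemma largest_eigenvalue_le:
  assumes A: "A \<in> carrier_mat n n" and n: "n > 0"
    and sym: "\<And>i j. i < n \<Longrightarrow> j < n \<Longrightarrow> A $$ (i, j) = A $$ (j, i)"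
    and form: "\<And>a. (\<Sum>i<n. \<Sum>j<n. a i * a j * A $$ (i, j)) \<le> b * (\<Sum>i<n. (a i)\<^sup>2)"
  shows "largest_eigenvalue A \<le> b"
proof -
  have "k \<le> b" if "k \<in> spectrum A" for k
  proof -
    from that obtain v where "eigenvector A v k" by (auto simp: spectrum_def eigenvalue_def)
    then have v: "v \<in> carrier_vec n" "v \<noteq> 0\<^sub>v n" "A *\<^sub>v v = k \<cdot>\<^sub>v v"
      using A by (auto simp: eigenvector_def)
    have row: "(\<Sum>j<n. A $$ (i, j) * v $ j) = k * v $ i" if "i < n" for i
    proof -
      have "(A *\<^sub>v v) $ i = (\<Sum>j<n. A $$ (i, j) * v $ j)"
        using A v(1) that by (simp add: scalar_prod_def atLeast0LessThan)
      then show ?thesis using v that by simp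
    qed
    have "k * (\<Sum>i<n. (v $ i)\<^sup>2) = (\<Sum>i<n. v $ i * (k * v $ i))"
      by (simp add: sum_distrib_left power2_eq_square mult_ac)
    also have "\<dots> = (\<Sum>i<n. v $ i * (\<Sum>j<n. A $$ (i, j) * v $ j))" using row by simp
    also have "\<dots> = (\<Sum>i<n. \<Sum>j<n. v $ i * v $ j * A $$ (i, j))"
      by (simp add: sum_distrib_left mult_ac)
    also have "\<dots> \<le> b * (\<Sum>i<n. (v $ i)\<^sup>2)" by (rule form)
    finally have "k * (\<Sum>i<n. (v $ i)\<^sup>2) \<le> b * (\<Sum>i<n. (v $ i)\<^sup>2)" .
    moreover have "(\<Sum>i<n. (v $ i)\<^sup>2) > 0"
    proof -
      have "\<exists>i<n. v $ i \<noteq> 0" using v(1,2) by auto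
      then obtain i where "i < n" "v $ i \<noteq> 0" by blast
      then show ?thesis by (intro sum_pos2[of _ i]) auto
    qed
    ultimately show "k \<le> b" by simp
  qed
  then show ?thesis
    using card_finite_spectrum(1)[OF A] spectrum_real_symmetric_nonempty[OF A n sym]
    by (simp add: largest_eigenvalue_def)
qed

lemma lovasz_theta_complement_le:
  fixes G :: "nat pair_pre_digraph"
  assumes G: "pair_graph G" and V: "pverts G = {..<n}" and n: "n \<ge> 1" and t: "t \<ge> 2"
    and free: "is_free (cycle_graph (2 * t)) G"
  shows "lovasz_theta (complement_graph G) \<le> 12 * real t * real n powr (1 / (2 * real t))"
proof -
  have vs: "sorted_list_of_set (pverts G) = [0..<n]"
    using V by (simp add: lessThan_atLeast0)
  have bound: "largest_eigenvalue (gram_matrix f [0..<n]) \<le> 12 * real t * real n powr (1 / (2 * real t))"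
    if f: "orthonormal_rep G d f" for d f
  proof (rule largest_eigenvalue_le)
    show "gram_matrix f [0..<n] \<in> carrier_mat n n" by (simp add: gram_matrix_def)
    show "gram_matrix f [0..<n] $$ (i, j) = gram_matrix f [0..<n] $$ (j, i)" if "i < n" "j < n" for i j
      using that f V comm_scalar_prod[of "f i" d "f j"] by (simp add: gram_matrix_def orthonormal_rep_def)
    have "\<not> has_cycle (\<lambda>u v. (u, v) \<in> parcs G) (2 * t)"
      using not_has_cycle_if_free[OF G free] t by simp
    from gram_quadratic_form_le[OF G V n t this f]
    show "(\<Sum>i<n. \<Sum>j<n. a i * a j * gram_matrix f [0..<n] $$ (i, j))
      \<le> 12 * real t * real n powr (1 / (2 * real t)) * (\<Sum>i<n. (a i)\<^sup>2)" for a
      by (simp add: gram_matrix_def)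
  qed (use n in simp)
  \<comment> \<open>The standard basis represents every graph on \<open>n\<close> vertices, so the
    supremum is over a nonempty set.\<close>
  have "orthonormal_rep G n (unit_vec n)"
    using V by (auto simp: orthonormal_rep_def)
  then show ?thesis
    unfolding lovasz_theta_complement[OF G] vs using bound by (intro cSup_least) blast+
qed

theorem theoremA1:
  fixes t n :: nat
  assumes "t \<ge> 2" and "n \<ge> 1"
  shows "lambda_free n (cycle_graph (2 * t)) \<le> 12 * real t * real n powr (1 / (2 * real t))"
  unfolding lambda_free_def
  using finite_free_graphs[of n "cycle_graph (2 * t)"] free_graphs_cycle_nonempty[of "2 * t" n] assms
    lovasz_theta_complement_le[OF _ _ assms(2,1)]
  by (subst Max_le_iff) (auto simp: free_graphs_def)

end
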